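(* Let $(X,d)$ be a nonempty compact metric space and let $T:X\to X$ be continuous. Let $K(X,T)$ be the set of all nonempty compact subsets $F\subseteq X$ with $T(F)\subseteq F$. If $F_1,F_2\in K(X,T)$ and $F_1\subseteq F_2$, then $D_{pre}(T|_{F_1},F_1)\le D_{pre}(T|_{F_2},F_2)$.
   Context: For $F\in K(X,T)$, $T|_F:F\to F$ denotes the induced map $T|_F(x)=T(x)$, and $(T|_F)^{-k}(x)=\{y\in F: T^k(y)=x\}$ for $x\in F$. For $n\in\mathbb{N}=\{1,2,\dots\}$ put $d_{T,n}(x,y)=\max_{0\le j<n}d(T^j(x),T^j(y))$. For $K\subseteq F$ and $\epsilon>0$, a set $E\subseteq K$ is an $(n,\epsilon,K,T|_F)$-separated set if $d_{T,n}(x,y)>\epsilon$ for all $x\ne y$ in $E$; $r(n,\epsilon,K,T|_F)$ denotes the maximal cardinality of an $(n,\epsilon,K,T|_F)$-separated subset of $K$. For real $s>0$, the $s$-preimage entropy of $T$ on $F$ is $$D_{pre}(s,T|_F,F)=\lim_{\epsilon\to 0}\limsup_{n\to\infty}\frac{1}{n^s}\log\sup_{x\in F,\,k\ge n}r(n,\epsilon,(T|_F)^{-k}(x),T|_F)\in[0,+\infty],$$ and the preimage entropy dimension of $T$ restricted to $F$ is $$D_{pre}(T|_F,F)=\inf\{s>0: D_{pre}(s,T|_F,F)=0\}=\sup\{s>0: D_{pre}(s,T|_F,F)=\infty\}\in[0,+\infty]$$ (with $\inf\emptyset=+\infty$ and $\sup\emptyset=0$). *)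

theory Defs
  imports "HOL-Analysis.Analysis"
begin

definition invariant_compacts :: "'a::metric_space set \<Rightarrow> ('a \<Rightarrow> 'a) \<Rightarrow> 'a set set" where
  "invariant_compacts X T = {F. F \<noteq> {} \<and> compact F \<and> F \<subseteq> X \<and> T ` F \<subseteq> F}"

(* Only used for n \<ge> 1, since Max {} is unspecified. *)
definition bowen_dist :: "('a::metric_space \<Rightarrow> 'a) \<Rightarrow> nat \<Rightarrow> 'a \<Rightarrow> 'a \<Rightarrow> real" where
  "bowen_dist T n x y = (MAX j\<in>{..<n}. dist ((T ^^ j) x) ((T ^^ j) y))"

definition separated :: "nat \<Rightarrow> real \<Rightarrow> 'a::metric_space set \<Rightarrow> ('a \<Rightarrow> 'a) \<Rightarrow> 'a set \<Rightarrow> bool" where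
  "separated n \<epsilon> K T E \<longleftrightarrow>
     E \<subseteq> K \<and> (\<forall>x\<in>E. \<forall>y\<in>E. x \<noteq> y \<longrightarrow> bowen_dist T n x y > \<epsilon>)"

(* Subsets of separated sets are separated, so restricting the supremum to finite sets
   loses nothing; an infinite separated set would give the value \<infinity>. *)
definition sep_card :: "nat \<Rightarrow> real \<Rightarrow> 'a::metric_space set \<Rightarrow> ('a \<Rightarrow> 'a) \<Rightarrow> enat" where
  "sep_card n \<epsilon> K T = (SUP E\<in>{E. finite E \<and> separated n \<epsilon> K T E}. enat (card E))"

definition preimage_on :: "('a \<Rightarrow> 'a) \<Rightarrow> 'a set \<Rightarrow> nat \<Rightarrow> 'a \<Rightarrow> 'a set" where
  "preimage_on T F k x = {y \<in> F. (T ^^ k) y = x}"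

definition max_preimage_sep :: "nat \<Rightarrow> real \<Rightarrow> ('a::metric_space \<Rightarrow> 'a) \<Rightarrow> 'a set \<Rightarrow> enat" where
  "max_preimage_sep n \<epsilon> T F =
     (SUP (x, k)\<in>F \<times> {n..}. sep_card n \<epsilon> (preimage_on T F k x) T)"

definition log_enat :: "enat \<Rightarrow> ereal" where
  "log_enat m = (case m of enat i \<Rightarrow> if i = 0 then -\<infinity> else ereal (ln (real i)) | \<infinity> \<Rightarrow> \<infinity>)"

definition preimage_growth :: "real \<Rightarrow> real \<Rightarrow> ('a::metric_space \<Rightarrow> 'a) \<Rightarrow> 'a set \<Rightarrow> ereal" where
  "preimage_growth s \<epsilon> T F =
     limsup (\<lambda>n. ereal (1 / real n powr s) * log_enat (max_preimage_sep n \<epsilon> T F))"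

definition preimage_entropy :: "real \<Rightarrow> ('a::metric_space \<Rightarrow> 'a) \<Rightarrow> 'a set \<Rightarrow> ereal" where
  "preimage_entropy s T F = Lim (at_right 0) (\<lambda>\<epsilon>. preimage_growth s \<epsilon> T F)"

(* In ereal, Inf {} = \<infinity>. *)
definition preimage_entropy_dim :: "('a::metric_space \<Rightarrow> 'a) \<Rightarrow> 'a set \<Rightarrow> ereal" where
  "preimage_entropy_dim T F = Inf {ereal s |s. s > 0 \<and> preimage_entropy s T F = 0}"


text \<open>The limit in \<^const>\<open>preimage_entropy\<close> exists, and the two descriptions of the
  dimension, by an infimum and by a supremum, agree.\<close>

lemma sep_card_mono: "\<epsilon> \<le> \<delta> \<Longrightarrow> sep_card n \<delta> K T \<le> sep_card n \<epsilon> K T"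
  unfolding sep_card_def separated_def by (rule SUP_subset_mono) force+

lemma log_enat_mono: "a \<le> b \<Longrightarrow> log_enat a \<le> log_enat b"
  by (cases a; cases b) (auto simp: log_enat_def)

lemma preimage_growth_mono:
  assumes "\<epsilon> \<le> \<delta>"
  shows "preimage_growth s \<delta> T F \<le> preimage_growth s \<epsilon> T F"
proof -
  have "max_preimage_sep n \<delta> T F \<le> max_preimage_sep n \<epsilon> T F" for n
    unfolding max_preimage_sep_def
    by (rule SUP_mono') (auto intro: sep_card_mono[OF assms])
  then show ?thesis
    unfolding preimage_growth_def
    by (intro Limsup_mono always_eventually allI ereal_mult_left_mono log_enat_mono) auto
qed

lemma preimage_entropy_limit:
  "((\<lambda>\<epsilon>. preimage_growth s \<epsilon> T F) \<longlongrightarrow> (SUP \<epsilon>\<in>{0<..}. preimage_growth s \<epsilon> T F)) (at_right 0)"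
proof (rule order_tendstoI)
  fix a assume "a < (SUP \<epsilon>\<in>{0<..}. preimage_growth s \<epsilon> T F)"
  then obtain \<delta> where \<delta>: "\<delta> > 0" "a < preimage_growth s \<delta> T F"
    by (auto simp: less_SUP_iff)
  have "a < preimage_growth s \<epsilon> T F" if "\<epsilon> < \<delta>" for \<epsilon>
    using \<delta>(2) preimage_growth_mono[OF less_imp_le[OF that]] by (rule less_le_trans)
  then show "\<forall>\<^sub>F \<epsilon> in at_right 0. a < preimage_growth s \<epsilon> T F"
    unfolding eventually_at_right_field using \<delta>(1) by blast
next
  fix a assume "(SUP \<epsilon>\<in>{0<..}. preimage_growth s \<epsilon> T F) < a"
  then have "preimage_growth s \<epsilon> T F < a" if "\<epsilon> > 0" for \<epsilon>
    by (meson SUP_lessD greaterThan_iff that)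
  then show "\<forall>\<^sub>F \<epsilon> in at_right 0. preimage_growth s \<epsilon> T F < a"
    unfolding eventually_at_right_field by (intro exI[of _ 1]) auto
qed

lemma preimage_entropy_eq_SUP:
  "preimage_entropy s T F = (SUP \<epsilon>\<in>{0<..}. preimage_growth s \<epsilon> T F)"
  unfolding preimage_entropy_def by (rule tendsto_Lim[OF _ preimage_entropy_limit]) simp

lemma max_preimage_sep_ge_1:
  assumes "F \<noteq> {}" "T ` F \<subseteq> F"
  shows "1 \<le> max_preimage_sep n \<epsilon> T F"
proof -
  obtain y where y: "y \<in> F" using assms by blast
  have x: "(T ^^ k) y \<in> F" for k
    using y assms(2) by (induction k) auto
  have "enat (card {y}) \<le> sep_card n \<epsilon> (preimage_on T F n ((T ^^ n) y)) T"
    unfolding sep_card_def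
    by (rule SUP_upper) (auto simp: separated_def preimage_on_def y)
  also have "\<dots> \<le> max_preimage_sep n \<epsilon> T F"
    unfolding max_preimage_sep_def
    by (rule SUP_upper2[where i = "((T ^^ n) y, n)"]) (auto simp: x)
  finally show ?thesis by (simp add: one_enat_def)
qed

lemma log_enat_nonneg: "1 \<le> m \<Longrightarrow> 0 \<le> log_enat m"
  by (cases m) (auto simp: log_enat_def one_enat_def)

lemma preimage_growth_nonneg:
  assumes "F \<noteq> {}" "T ` F \<subseteq> F"
  shows "0 \<le> preimage_growth s \<epsilon> T F"
  unfolding preimage_growth_def
  by (rule le_Limsup)
    (auto intro!: always_eventually ereal_0_le_mult log_enat_nonneg max_preimage_sep_ge_1[OF assms])

lemma preimage_entropy_eq_0:
  assumes F: "F \<noteq> {}" "T ` F \<subseteq> F"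
    and st: "s < t" and fin: "preimage_entropy s T F \<noteq> \<infinity>"
  shows "preimage_entropy t T F = 0"
proof -
  have "preimage_growth t \<epsilon> T F = 0" if \<epsilon>: "\<epsilon> > 0" for \<epsilon>
  proof (rule antisym)
    define a where "a n = log_enat (max_preimage_sep n \<epsilon> T F)" for n
    have a0: "0 \<le> a n" for n
      unfolding a_def by (intro log_enat_nonneg max_preimage_sep_ge_1[OF F])
    have "preimage_growth s \<epsilon> T F \<le> preimage_entropy s T F"
      unfolding preimage_entropy_eq_SUP using \<epsilon> by (intro SUP_upper) auto
    also have "\<dots> < \<infinity>" using fin by simp
    finally obtain C where C: "preimage_growth s \<epsilon> T F < ereal C"
      by (auto dest: less_PInf_Ex_of_nat[THEN iffD1])
    then have ev: "\<forall>\<^sub>F n in sequentially. ereal (1 / real n powr s) * a n < ereal C"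
      unfolding preimage_growth_def a_def by (rule Limsup_lessD)
    have ev2: "\<forall>\<^sub>F n in sequentially.
        ereal (1 / real n powr t) * a n \<le> ereal (C * real n powr (s - t))"
      using ev eventually_gt_at_top[of 0]
    proof eventually_elim
      case (elim n)
      show ?case
      proof (cases "a n")
        case (real r)
        with elim have "1 / real n powr s * r < C" by simp
        then have "1 / real n powr s * r * real n powr (s - t) \<le> C * real n powr (s - t)"
          by (intro mult_right_mono) auto
        then show ?thesis using real elim by (simp add: powr_diff)
      qed (use a0[of n] elim in auto)
    qed
    have "(\<lambda>n. C * real n powr (s - t)) \<longlonglongrightarrow> C * 0"
      by (intro tendsto_mult tendsto_const tendsto_neg_powr filterlim_real_sequentially)
        (use st in auto)
    then have "limsup (\<lambda>n. ereal (C * real n powr (s - t))) = 0"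
      by (intro lim_imp_Limsup) (simp_all add: zero_ereal_def)
    with Limsup_mono[OF ev2] show "preimage_growth t \<epsilon> T F \<le> 0"
      by (simp add: preimage_growth_def a_def)
  qed (rule preimage_growth_nonneg[OF F])
  then show ?thesis
    unfolding preimage_entropy_eq_SUP by (subst SUP_cong[OF refl, where D = "\<lambda>_. 0"]) auto
qed

(* Sup {} = 0 as a supremum of nonnegative numbers; hence the 0 inserted below. *)
lemma preimage_entropy_dim_eq_Sup:
  assumes F: "F \<noteq> {}" "T ` F \<subseteq> F"
  shows "preimage_entropy_dim T F =
    Sup (insert 0 {ereal s |s. s > 0 \<and> preimage_entropy s T F = \<infinity>})"
    (is "_ = Sup ?B")
proof (rule antisym)
  show "Sup ?B \<le> preimage_entropy_dim T F"
    unfolding preimage_entropy_dim_def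
  proof (intro Sup_least Inf_greatest)
    fix b a assume "b \<in> ?B" and "a \<in> {ereal s |s. s > 0 \<and> preimage_entropy s T F = 0}"
    then show "b \<le> a"
      using preimage_entropy_eq_0[OF F] by (force simp: not_less[symmetric])
  qed
  show "preimage_entropy_dim T F \<le> Sup ?B"
  proof (rule ccontr)
    assume "\<not> ?thesis"
    then have "Sup ?B < preimage_entropy_dim T F" by (simp only: not_le)
    from ereal_dense2[OF this]
    obtain t where t: "Sup ?B < ereal t" "ereal t < preimage_entropy_dim T F" by blast
    from ereal_dense2[OF t(1)] obtain s where s: "Sup ?B < ereal s" "s < t" by auto
    have "0 \<le> Sup ?B" by (rule Sup_upper) simp
    then have "0 < ereal s" using s(1) by (rule le_less_trans)
    then have "0 < s" by simp
    moreover have "ereal s \<notin> ?B" using s(1) Sup_upper[of "ereal s" ?B] by (meson not_le)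
    ultimately have "preimage_entropy s T F \<noteq> \<infinity>" by auto
    then have "preimage_entropy t T F = 0" using preimage_entropy_eq_0[OF F s(2)] by simp
    then have "preimage_entropy_dim T F \<le> ereal t"
      unfolding preimage_entropy_dim_def using \<open>0 < s\<close> s(2) by (intro Inf_lower) auto
    with t(2) show False by simp
  qed
qed

end

theory Submission
  imports Defs
begin

text \<open>Orbits starting in the smaller invariant set never leave it, so both restricted maps
  give them the same iterates and Bowen distances. A separated set in a preimage fibre of the
  smaller system is therefore separated in the fibre of the larger one over the same point
  (\<open>max_preimage_sep_mono_set\<close>). Entropy is thus monotone, and since it is nonnegative,
  its vanishing on the larger set forces vanishing on the smaller. The lemmas allow two maps
  \<open>S\<close> and \<open>T\<close> agreeing on \<open>A\<close>, because restrictions to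
  different sets are different total functions.\<close>

lemma funpow_eq_on_invariant:
  assumes "S ` A \<subseteq> A" "\<And>x. x \<in> A \<Longrightarrow> S x = T x" "x \<in> A"
  shows "(S ^^ j) x = (T ^^ j) x" and "(S ^^ j) x \<in> A"
  using assms by (induction j) auto

lemma bowen_dist_eq_on_invariant:
  assumes "S ` A \<subseteq> A" "\<And>x. x \<in> A \<Longrightarrow> S x = T x" "x \<in> A" "y \<in> A"
  shows "bowen_dist S n x y = bowen_dist T n x y"
  unfolding bowen_dist_def using funpow_eq_on_invariant(1)[OF assms(1,2)] assms(3,4) by simp

lemma max_preimage_sep_mono_set:
  assumes "S ` A \<subseteq> A" "\<And>x. x \<in> A \<Longrightarrow> S x = T x" "A \<subseteq> B"
  shows "max_preimage_sep n \<epsilon> S A \<le> max_preimage_sep n \<epsilon> T B"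
proof -
  have "sep_card n \<epsilon> (preimage_on S A k x) S \<le> sep_card n \<epsilon> (preimage_on T B k x) T" for k x
    unfolding sep_card_def
  proof (rule SUP_subset_mono)
    show "{E. finite E \<and> separated n \<epsilon> (preimage_on S A k x) S E}
      \<subseteq> {E. finite E \<and> separated n \<epsilon> (preimage_on T B k x) T E}"
    proof clarify
      fix E assume E: "separated n \<epsilon> (preimage_on S A k x) S E"
      then have A: "y \<in> A" if "y \<in> E" for y
        using that by (auto simp: separated_def preimage_on_def)
      have "E \<subseteq> preimage_on T B k x"
        using E funpow_eq_on_invariant(1)[OF assms(1,2)] assms(3)
        by (fastforce simp: separated_def preimage_on_def)
      then show "separated n \<epsilon> (preimage_on T B k x) T E"
        using E bowen_dist_eq_on_invariant[OF assms(1,2) A A] by (auto simp: separated_def)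
    qed
  qed simp
  then show ?thesis
    unfolding max_preimage_sep_def using assms(3)
    by (intro SUP_mono) fastforce
qed

text \<open>Writing the limit at 0 as a supremum over positive \<epsilon> leaves only monotone
  operations: logarithm, nonnegative scaling, limsup, supremum.\<close>

lemma preimage_entropy_mono_set:
  assumes "S ` A \<subseteq> A" "\<And>x. x \<in> A \<Longrightarrow> S x = T x" "A \<subseteq> B"
  shows "preimage_entropy s S A \<le> preimage_entropy s T B"
  unfolding preimage_entropy_eq_SUP preimage_growth_def
  by (intro SUP_mono' Limsup_mono always_eventually allI ereal_mult_left_mono log_enat_mono
      max_preimage_sep_mono_set assms) auto

lemma preimage_entropy_nonneg:
  assumes "F \<noteq> {}" "T ` F \<subseteq> F"
  shows "0 \<le> preimage_entropy s T F"
  unfolding preimage_entropy_eq_SUP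
  \<comment> \<open>Any positive scale would serve in place of 1.\<close>
  by (rule SUP_upper2[where i = 1]) (auto intro: preimage_growth_nonneg[OF assms])

lemma preimage_entropy_dim_mono_set:
  assumes "A \<noteq> {}" "S ` A \<subseteq> A" "\<And>x. x \<in> A \<Longrightarrow> S x = T x" "A \<subseteq> B"
  shows "preimage_entropy_dim S A \<le> preimage_entropy_dim T B"
proof -
  have "preimage_entropy s S A = 0" if "preimage_entropy s T B = 0" for s
    using preimage_entropy_mono_set[OF assms(2-4), of s] preimage_entropy_nonneg[OF assms(1,2), of s]
      that by simp
  then show ?thesis
    unfolding preimage_entropy_dim_def by (intro Inf_superset_mono) auto
qed

theorem proposition2p6:
  fixes X :: "'a::metric_space set" and T :: "'a \<Rightarrow> 'a" and F\<^sub>1 F\<^sub>2 :: "'a set"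
  assumes "X \<noteq> {}" and "compact X"
    and "continuous_on X T" and "T ` X \<subseteq> X"
    and "F\<^sub>1 \<in> invariant_compacts X T" and "F\<^sub>2 \<in> invariant_compacts X T"
    and "F\<^sub>1 \<subseteq> F\<^sub>2"
  shows "preimage_entropy_dim (restrict T F\<^sub>1) F\<^sub>1 \<le> preimage_entropy_dim (restrict T F\<^sub>2) F\<^sub>2"
  \<comment> \<open>Both restrictions coincide with \<open>T\<close> on \<open>F\<^sub>1\<close>,
    since \<open>F\<^sub>1\<close> lies in \<open>F\<^sub>2\<close>.\<close>
  using assms(5,7) by (intro preimage_entropy_dim_mono_set) (auto simp: invariant_compacts_def)

end
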